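(* For all integers $d\geq 62$ and $n\geq 1$, \[ \Delta_d^{(2,-)}(n) := q_d^{(2)}(n) - Q_d^{(2,-)}(n) \geq 0 . \]
   Context: A partition of $n$ is a non-increasing sequence of positive integers (parts) summing to $n$. For positive integers $a,d,n$, $q_d^{(a)}(n)$ denotes the number of partitions of $n$ in which every part is at least $a$ and any two parts differ by at least $d$. For $1\le b\le d+2$, $Q_d^{(b,-)}(n)$ denotes the number of partitions of $n$ into parts congruent to $\pm b \pmod{d+3}$, where the single part $d+3-b$ is not allowed. In particular $Q_d^{(2,-)}(n)$ counts partitions of $n$ into parts $\equiv \pm 2 \pmod{d+3}$ excluding the part $d+1$. *)

theory Defs
  imports "HOL-Number_Theory.Cong"
begin

definition partitions :: "nat \<Rightarrow> nat list set" where
  "partitions n = {xs. sorted_wrt (\<ge>) xs \<and> (\<forall>x\<in>set xs. 0 < x) \<and> sum_list xs = n}"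

lemma finite_partitions: "finite (partitions n)"
proof (rule finite_subset)
  show "partitions n \<subseteq> {xs. set xs \<subseteq> {..n} \<and> length xs \<le> n}"
  proof
    fix xs assume "xs \<in> partitions n"
    then have pos: "\<forall>x\<in>set xs. 0 < x" and s: "sum_list xs = n"
      by (auto simp: partitions_def)
    have "length xs \<le> sum_list xs"
      using pos by (induction xs) auto
    moreover have "set xs \<subseteq> {..n}"
      using s member_le_sum_list by fastforce
    ultimately show "xs \<in> {xs. set xs \<subseteq> {..n} \<and> length xs \<le> n}"
      using s by simp
  qed
  show "finite {xs. set xs \<subseteq> {..n} \<and> length xs \<le> n}"
    by (rule finite_lists_length_le) simp
qed

text \<open>Parts are listed in non-increasing order, so the difference of the parts at positions
  \<open>i < j\<close> is \<open>xs ! i - xs ! j\<close>; the condition is written additively to avoid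
  truncated subtraction. It ranges over pairs of positions, so for \<open>d > 0\<close> repeated parts
  are excluded.\<close>

definition q :: "nat \<Rightarrow> nat \<Rightarrow> nat \<Rightarrow> nat" where
  "q a d n = card {xs \<in> partitions n.
     (\<forall>x\<in>set xs. a \<le> x) \<and>
     (\<forall>i j. i < j \<longrightarrow> j < length xs \<longrightarrow> xs ! j + d \<le> xs ! i)}"

text \<open>Intended for \<open>1 \<le> b \<le> d + 2\<close>, where the subtraction \<open>d + 3 - b\<close> does
  not truncate.\<close>

definition Q_minus :: "nat \<Rightarrow> nat \<Rightarrow> nat \<Rightarrow> nat" where
  "Q_minus b d n = card {xs \<in> partitions n.
     \<forall>x\<in>set xs. ([int x = int b] (mod int (d + 3)) \<or> [int x = - int b] (mod int (d + 3)))
       \<and> x \<noteq> d + 3 - b}"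

text \<open>The superscript of \<open>\<Delta>\<close> is both the lower bound on the parts counted by
  \<open>q\<close> and the residue used in \<open>Q_minus\<close>.\<close>

definition Delta_minus :: "nat \<Rightarrow> nat \<Rightarrow> nat \<Rightarrow> int" where
  "Delta_minus b d n = int (q b d n) - int (Q_minus b d n)"

end

theory Submission
  imports Complex_Main "HOL-Library.FuncSet" "HOL-Library.Multiset" Defs
begin

text \<open>Write \<open>m = n div (d + 2)\<close>. In a partition counted by \<open>Q_minus\<close> the number of twos is
  determined by the other parts \<open>k (d + 3) \<plusminus> 2\<close>, whose indices \<open>k\<close> sum to at most \<open>m\<close>; only one
  part has index 1, and two have each larger index. Hence \<open>Q_minus 2 d n\<close> is at most
  \<open>z\<^sup>-\<^sup>m (1 - z) / (\<Prod>k. 1 - z\<^sup>k)\<^sup>2\<close> for every \<open>0 < z < 1\<close>, a bound of order \<open>exp (C \<surd>m)\<close> that does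
  not depend on \<open>d\<close>. On the other side, subtracting a staircase shows that \<open>q 2 d n\<close> is at least the
  number of partitions of \<open>n - 2 j - d j (j - 1) / 2\<close> into at most \<open>j\<close> parts, hence at least
  \<open>x\<^sup>j\<^sup>-\<^sup>1 / (j! (j - 1)!)\<close> with \<open>x = 62 (m - j (j - 1) / 2)\<close>. Choosing \<open>j\<close> near \<open>\<surd>m\<close> and \<open>z\<close> suitably
  (\<open>1/2\<close> for \<open>m \<le> 10\<close>, \<open>2/3\<close> for \<open>m \<le> 63\<close>, and \<open>j / (j + 2)\<close> beyond), the lower bound wins for
  all \<open>m \<ge> 2\<close>.\<close>

subsection \<open>Partitions with gaps\<close>

text \<open>Mean value estimate for the power function; it bounds the loss in
  \<open>x ^ Suc j\<close> when the excess \<open>x\<close> in \<open>card_gapped_ge\<close> drops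
  by the number of parts.\<close>

lemma power_diff_le:
  fixes x y :: real
  assumes "0 \<le> y" "y \<le> x"
  shows "x ^ Suc p - y ^ Suc p \<le> (x - y) * Suc p * x ^ p"
proof (induction p)
  case (Suc p)
  have "x ^ Suc (Suc p) - y ^ Suc (Suc p) = x * (x ^ Suc p - y ^ Suc p) + (x - y) * y ^ Suc p"
    by (simp add: algebra_simps)
  also have "\<dots> \<le> x * ((x - y) * Suc p * x ^ p) + (x - y) * x ^ Suc p"
    using assms Suc by (intro add_mono mult_left_mono power_mono) auto
  also have "\<dots> = (x - y) * Suc (Suc p) * x ^ Suc p"
    by (simp add: algebra_simps)
  finally show ?case .
qed simp

text \<open>With the number of parts fixed, a recursion on the smallest part is available: removing
  it lowers \<open>j\<close>, raising the bound \<open>a\<close> keeps \<open>j\<close>.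
  \<open>sorted_wrt\<close> imposes the gap on all pairs, as in \<open>q\<close>.\<close>

definition gapped :: "nat \<Rightarrow> nat \<Rightarrow> nat \<Rightarrow> nat \<Rightarrow> nat list set" where
  "gapped a d j n = {xs. sorted_wrt (\<lambda>x y. y + d \<le> x) xs \<and> (\<forall>x\<in>set xs. a \<le> x) \<and>
     sum_list xs = n \<and> length xs = j}"

lemma finite_gapped: "finite (gapped a d j n)"
proof (rule finite_subset)
  show "gapped a d j n \<subseteq> {xs. set xs \<subseteq> {..n} \<and> length xs = j}"
    using member_le_sum_list by (fastforce simp: gapped_def)
qed (simp add: finite_lists_length_eq)

text \<open>Split according to whether the smallest part is \<open>a\<close>.\<close>

lemma card_gapped_Suc_ge:
  assumes "a \<le> n"
  shows "card (gapped (a + d) d j (n - a)) + card (gapped (a + 1) d (Suc j) n)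
    \<le> card (gapped a d (Suc j) n)"
proof -
  let ?A = "(\<lambda>xs. xs @ [a]) ` gapped (a + d) d j (n - a)"
  let ?B = "gapped (a + 1) d (Suc j) n"
  have "?A \<inter> ?B = {}"
  proof -
    have "a \<in> set xs" if "xs \<in> ?A" for xs
      using that by force
    moreover have "a \<notin> set xs" if "xs \<in> ?B" for xs
      using that unfolding gapped_def by force
    ultimately show ?thesis by blast
  qed
  moreover have "?A \<union> ?B \<subseteq> gapped a d (Suc j) n"
  proof -
    have "xs @ [a] \<in> gapped a d (Suc j) n" if "xs \<in> gapped (a + d) d j (n - a)" for xs
      using that assms unfolding gapped_def
      by (simp add: sorted_wrt_append) (meson add_leD1)
    moreover have "?B \<subseteq> gapped a d (Suc j) n"
      unfolding gapped_def by (simp add: Collect_mono_iff Suc_le_eq less_imp_le)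
    ultimately show ?thesis by blast
  qed
  moreover have "card ?A = card (gapped (a + d) d j (n - a))"
    by (rule card_image) (auto simp: inj_on_def)
  ultimately show ?thesis
    using card_mono[OF finite_gapped, of "?A \<union> ?B" a d "Suc j" n]
    by (simp add: card_Un_disjoint finite_gapped)
qed

text \<open>Here \<open>x\<close> is the excess over the staircase
  \<open>a, a + d, ..., a + j * d\<close>, so the set corresponds to the partitions of
  \<open>x\<close> into at most \<open>Suc j\<close> parts. Their number satisfies p(J, x) \<ge> p(J
  - 1, x) + p(J, x - J), and the left-hand side grows no faster than this recursion forces.\<close>

lemma card_gapped_ge:
  "real x ^ j / (fact (Suc j) * fact j)
    \<le> card (gapped a d (Suc j) (Suc j * a + d * (\<Sum>i\<le>j. i) + x))"
proof (induction j arbitrary: a x)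
  case 0
  have "{[a + x]} \<subseteq> gapped a d 1 (a + x)"
    by (auto simp: gapped_def)
  from card_mono[OF finite_gapped this] show ?case
    by simp
next
  case (Suc j)
  let ?D = "fact (Suc (Suc j)) * fact (Suc j) :: real"
  let ?J = "Suc (Suc j)"
  have D: "?D = real (?J * Suc j) * (fact (Suc j) * fact j)"
    by (simp add: algebra_simps)
  \<comment> \<open>Removing a smallest part \<open>a\<close> leaves \<open>Suc j\<close> parts of
    size at least \<open>a + d\<close> with the same excess \<open>x\<close>.\<close>
  have tail: "real x ^ j * (?J * Suc j) / ?D
    \<le> card (gapped (a + d) d (Suc j) (?J * a + d * (\<Sum>i\<le>Suc j. i) + x - a))" for a x
  proof -
    have n: "?J * a + d * (\<Sum>i\<le>Suc j. i) + x - a = Suc j * (a + d) + d * (\<Sum>i\<le>j. i) + x"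
      by (simp add: algebra_simps)
    have "real x ^ j * (?J * Suc j) / ?D = real x ^ j / (fact (Suc j) * fact j)"
      unfolding D by (subst mult.commute, rule nonzero_mult_divide_mult_cancel_left)
        (simp del: of_nat_Suc)
    then show ?thesis
      using Suc[of x "a + d"] unfolding n by (simp only:)
  qed
  show ?case
  proof (induction x arbitrary: a rule: less_induct)
    case (less x)
    let ?n = "?J * a + d * (\<Sum>i\<le>Suc j. i) + x"
    have rec: "card (gapped (a + d) d (Suc j) (?n - a)) + card (gapped (a + 1) d ?J ?n)
        \<le> card (gapped a d ?J ?n)"
      by (rule card_gapped_Suc_ge) simp
    show ?case
    proof (cases "?J \<le> x")
      case True
      \<comment> \<open>Raising all \<open>?J\<close> parts of the staircase by 1 uses up
        \<open>?J\<close> of the excess.\<close>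
      have n: "?n = ?J * (a + 1) + d * (\<Sum>i\<le>Suc j. i) + (x - ?J)"
        using True by (simp add: algebra_simps)
      have IH: "real (x - ?J) ^ Suc j / ?D \<le> card (gapped (a + 1) d ?J ?n)"
        unfolding n using True by (intro less) auto
      have "real x ^ Suc j \<le> real (x - ?J) ^ Suc j + real x ^ j * (?J * Suc j)"
        using power_diff_le[of "real (x - ?J)" "real x" j] True
        by (simp add: of_nat_diff algebra_simps)
      then have "real x ^ Suc j / ?D \<le> (real (x - ?J) ^ Suc j + real x ^ j * (?J * Suc j)) / ?D"
        by (intro divide_right_mono) auto
      also have "\<dots> = real (x - ?J) ^ Suc j / ?D + real x ^ j * (?J * Suc j) / ?D"
        by (simp add: add_divide_distrib)
      finally show ?thesis
        using rec IH tail[of x a] by linarith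
    next
      case False
      \<comment> \<open>For so small an excess the partitions with smallest part \<open>a\<close>
        already suffice.\<close>
      then have "x \<le> ?J * Suc j"
        by simp
      then have "real x \<le> ?J * Suc j"
        by (simp only: of_nat_le_iff)
      then have "real x ^ j * real x \<le> real x ^ j * (?J * Suc j)"
        by (intro mult_left_mono) auto
      then have "real x ^ Suc j / ?D \<le> real x ^ j * (?J * Suc j) / ?D"
        by (intro divide_right_mono) (simp_all only: power_Suc2 zero_le_mult_iff fact_ge_zero simp_thms)
      then show ?thesis
        using rec tail[of x a] by linarith
    qed
  qed
qed

subsection \<open>The product of \<open>1 - z\<^sup>k\<close>\<close>

lemma inverse_squares_partial: "(\<Sum>i<N. 1 / real (Suc i) ^ 2) \<le> 7/4"
proof -
  \<comment> \<open>The subtracted term makes the induction telescope. Starting from two terms, 1 +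
    1/4 = 7/4 - 1/2, keeps the constant close to \<pi>^2/6.\<close>
  have "(\<Sum>i<N + 2. 1 / real (Suc i) ^ 2) \<le> 7/4 - 1 / real (N + 2)" for N
  proof (induction N)
    case 0
    show ?case by (simp add: numeral_2_eq_2 power2_eq_square)
  next
    case (Suc N)
    have "1 / real (Suc (N + 2)) ^ 2 \<le> 1 / (real (N + 2) * real (Suc (N + 2)))"
      by (intro divide_left_mono) (auto simp: power2_eq_square)
    also have "\<dots> = 1 / real (N + 2) - 1 / real (Suc N + 2)"
      by (simp add: field_simps)
    finally show ?case using Suc by simp
  qed
  from this[of N] have "(\<Sum>i<N + 2. 1 / real (Suc i) ^ 2) \<le> 7/4"
    by (smt (verit) divide_nonneg_nonneg of_nat_0_le_iff)
  moreover have "(\<Sum>i<N. 1 / real (Suc i) ^ 2) \<le> (\<Sum>i<N + 2. 1 / real (Suc i) ^ 2)"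
    by (intro sum_mono2) auto
  ultimately show ?thesis by linarith
qed

lemma minus_ln_one_minus_sums:
  fixes y :: real
  assumes "0 < y" "y < 1"
  shows "(\<lambda>i. y ^ Suc i / Suc i) sums (- ln (1 - y))"
proof -
  have "summable (\<lambda>i. y ^ Suc i)"
    using assms summable_geometric[of y] by (subst summable_Suc_iff) auto
  then have "summable (\<lambda>i. y ^ Suc i / Suc i)"
  proof (rule summable_comparison_test')
    fix i :: nat
    have "y ^ Suc i / Suc i \<le> y ^ Suc i / 1"
      using assms by (intro divide_left_mono) auto
    then show "norm (y ^ Suc i / Suc i) \<le> y ^ Suc i"
      using assms by simp
  qed
  moreover have "- ln (1 - y) = (\<Sum>i. y ^ Suc i / Suc i)"
  proof -
    have "(-1) ^ i * (1 / real (i + 1)) * (1 - y - 1) ^ Suc i = - (y ^ Suc i / Suc i)" for i :: nat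
      by (simp flip: power_mult_distrib)
    then have "ln (1 - y) = (\<Sum>i. - (y ^ Suc i / Suc i))"
      using ln_series[of "1 - y"] assms by (simp only:)
    then show ?thesis
      using suminf_minus[OF calculation] by simp
  qed
  ultimately show ?thesis by (simp add: sums_iff)
qed

text \<open>Expanding \<open>- ln (1 - z\<^sup>k)\<close> and summing over \<open>k\<close> first gives the series of
  \<open>w / ((1 - w) i)\<close> with \<open>w = z\<^sup>i\<close>, and \<open>w / (1 - w) \<le> z / ((1 - z) i)\<close>.\<close>

lemma prod_one_minus_power_ge:
  fixes z :: real
  assumes z: "0 < z" "z < 1"
  shows "exp (- (7/4 * (z / (1 - z)))) \<le> (\<Prod>k=1..n. 1 - z ^ k)"
proof -
  have bound: "(\<Sum>k=1..n. (z ^ k) ^ Suc i / Suc i) \<le> z / (1 - z) * (1 / real (Suc i) ^ 2)" for i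
  proof -
    define w where "w = z ^ Suc i"
    have w: "0 < w" "w < 1"
      using z power_Suc_less_one[of z i] by (auto simp: w_def)
    have "(\<Sum>k=1..n. (z ^ k) ^ Suc i) = (\<Sum>k=1..n. w ^ k)"
      by (simp add: w_def mult.commute flip: power_mult power_Suc)
    also have "\<dots> \<le> w / (1 - w)"
    proof -
      have "(\<Sum>k=1..n. w ^ k) = w * (1 - w ^ n) / (1 - w)"
        using w by (subst sum_gp) (auto simp: algebra_simps)
      also have "\<dots> \<le> w / (1 - w)"
        using w by (intro divide_right_mono) (auto simp: mult_le_cancel_left1)
      finally show ?thesis .
    qed
    also have "\<dots> \<le> z / (1 - z) / Suc i"
    proof -
      \<comment> \<open>Each of the \<open>Suc i\<close> terms of the geometric sum for
        \<open>(1 - w) / (1 - z)\<close> is at least \<open>z ^ i\<close>.\<close>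
      have "Suc i * z ^ i = (\<Sum>k<Suc i. z ^ i)"
        by simp
      also have "\<dots> \<le> (\<Sum>k<Suc i. z ^ k)"
        using z by (intro sum_mono power_decreasing) auto
      finally have "(1 - z) * (Suc i * z ^ i) \<le> 1 - w"
        using z unfolding w_def one_diff_power_eq by (intro mult_left_mono) auto
      then have "z * ((1 - z) * (Suc i * z ^ i)) \<le> z * (1 - w)"
        using z by (intro mult_left_mono) auto
      then have "w * ((1 - z) * Suc i) \<le> z * (1 - w)"
        by (simp add: w_def algebra_simps)
      then show ?thesis
        using z w by (simp add: divide_simps mult_ac)
    qed
    finally have "(\<Sum>k=1..n. (z ^ k) ^ Suc i) / Suc i \<le> z / (1 - z) / Suc i / Suc i"
      by (intro divide_right_mono) auto
    also have "\<dots> = z / (1 - z) * (1 / real (Suc i) ^ 2)"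
      by (simp add: power2_eq_square)
    finally show ?thesis
      unfolding sum_divide_distrib .
  qed
  have zk: "0 < z ^ k" "z ^ k < 1" if "k \<in> {1..n}" for k
    using z that power_strict_decreasing[of 0 k z] by auto
  have sums: "(\<lambda>i. \<Sum>k=1..n. (z ^ k) ^ Suc i / Suc i) sums (\<Sum>k=1..n. - ln (1 - z ^ k))"
    by (intro sums_sum minus_ln_one_minus_sums zk)
  have partial: "(\<Sum>i<N. \<Sum>k=1..n. (z ^ k) ^ Suc i / Suc i) \<le> 7/4 * (z / (1 - z))" for N
  proof -
    have "(\<Sum>i<N. \<Sum>k=1..n. (z ^ k) ^ Suc i / Suc i)
        \<le> z / (1 - z) * (\<Sum>i<N. 1 / real (Suc i) ^ 2)"
      unfolding sum_distrib_left by (intro sum_mono bound)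
    also have "\<dots> \<le> z / (1 - z) * (7/4)"
      using z by (intro mult_left_mono inverse_squares_partial) auto
    also have "\<dots> = 7/4 * (z / (1 - z))"
      by (rule mult.commute)
    finally show ?thesis .
  qed
  \<comment> \<open>The uniform bound on the partial sums passes to the limit.\<close>
  have "(\<Sum>k=1..n. - ln (1 - z ^ k)) \<le> 7/4 * (z / (1 - z))"
    using partial by (intro LIMSEQ_le_const2[OF sums[unfolded sums_def]]) blast
  moreover have "(\<Prod>k=1..n. 1 - z ^ k) = exp (\<Sum>k=1..n. ln (1 - z ^ k))"
    unfolding exp_sum[OF finite_atLeastAtMost] using zk by (intro prod.cong) simp_all
  ultimately show ?thesis
    by (simp only: sum_negf exp_le_cancel_iff)
qed

lemma prod_one_minus_half_power_ge: "9/32 \<le> (\<Prod>k=1..n. 1 - (1/2::real) ^ k)"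
proof -
  \<comment> \<open>The correction term makes the bound inductive; it is an equality at two factors
    (3/8), and the step needs \<open>e \<le> 1/4\<close>, hence the shift by 2. The two extra
    factors only lower the product and are dropped afterwards.\<close>
  have ge2: "9/32 * (1 + 4/3 * (1/2) ^ (n + 2)) \<le> (\<Prod>k=1..n + 2. 1 - (1/2::real) ^ k)" for n
  proof (induction n)
    case 0
    show ?case by (simp add: numeral_2_eq_2 power2_eq_square)
  next
    case (Suc n)
    define e :: real where "e = (1/2) ^ (n + 2)"
    have e: "0 < e" "e \<le> 1/4"
      using power_decreasing[of 2 "n + 2" "1/2::real"] by (auto simp: e_def power2_eq_square)
    have "0 \<le> 3/16 * (e * (1/4 - e))"
      using e by (intro mult_nonneg_nonneg) auto
    also have "\<dots> = 9/32 * (1 + 4/3 * e) * (1 - e / 2) - 9/32 * (1 + 4/3 * (e / 2))"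
      by (simp add: field_simps)
    finally have "9/32 * (1 + 4/3 * (e / 2)) \<le> 9/32 * (1 + 4/3 * e) * (1 - e / 2)"
      by simp
    also have "\<dots> \<le> (\<Prod>k=1..n + 2. 1 - (1/2::real) ^ k) * (1 - e / 2)"
      using Suc e by (intro mult_right_mono) (auto simp: e_def)
    finally show ?case by (simp add: e_def)
  qed
  have "9/32 \<le> (\<Prod>k=1..n + 2. 1 - (1/2::real) ^ k)"
    by (rule order_trans[OF _ ge2]) simp
  also have "\<dots> \<le> (\<Prod>k=1..n. 1 - (1/2::real) ^ k)"
  proof -
    let ?P = "\<Prod>k=1..n. 1 - (1/2::real) ^ k"
    have "(\<Prod>k=1..n + 2. 1 - (1/2::real) ^ k) = ?P * ((1 - (1/2) ^ (n + 1)) * (1 - (1/2) ^ (n + 2)))"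
      by simp
    also have "\<dots> \<le> ?P"
      by (intro mult_left_le mult_le_one prod_nonneg)
        (auto simp: power_le_one order_trans[OF power_le_one])
    finally show ?thesis .
  qed
  finally show ?thesis .
qed

subsection \<open>Partitions into parts congruent to plus or minus 2\<close>

text \<open>The set counted by \<open>Q_minus 2 d n\<close>, with the condition kept
  verbatim.\<close>

definition Q_partitions :: "nat \<Rightarrow> nat \<Rightarrow> nat list set" where
  "Q_partitions d n = {xs \<in> partitions n. \<forall>x\<in>set xs.
     ([int x = int 2] (mod int (d + 3)) \<or> [int x = - int 2] (mod int (d + 3))) \<and> x \<noteq> d + 3 - 2}"

text \<open>The admissible parts other than 2. The excluded part \<open>d + 1\<close> is the case \<open>k = 1\<close> of
  \<open>k * (d + 3) - 2\<close>.\<close>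

definition big_parts :: "nat \<Rightarrow> nat \<Rightarrow> nat set" where
  "big_parts d n = {p. p \<le> n \<and> (\<exists>k\<ge>1. p = k * (d + 3) + 2 \<or> p + 2 = k * (d + 3) \<and> k \<noteq> 1)}"

lemma finite_big_parts: "finite (big_parts d n)"
  by (rule finite_subset[of _ "{..n}"]) (auto simp: big_parts_def)

text \<open>In the class of 2, quotient 0 gives the part 2 itself. In the class of -2,
  \<open>x + 2 = k * (d + 3)\<close>, where \<open>k = 0\<close> fails by size and
  \<open>k = 1\<close> is the excluded part.\<close>

lemma part_cases:
  assumes "[int x = int 2] (mod int (d + 3)) \<or> [int x = - int 2] (mod int (d + 3))"
    and "x \<noteq> d + 3 - 2" "x \<le> n" "0 < x" "0 < d"
  shows "x = 2 \<or> x \<in> big_parts d n"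
  using assms(1)
proof
  assume "[int x = int 2] (mod int (d + 3))"
  then have "[x = 2] (mod d + 3)"
    by (simp only: cong_int_iff)
  then have "x mod (d + 3) = 2"
    using \<open>0 < d\<close> by (simp add: cong_def)
  then have "x = x div (d + 3) * (d + 3) + 2"
    by (metis div_mult_mod_eq)
  then show ?thesis
    using \<open>x \<le> n\<close> unfolding big_parts_def
    by (cases "x div (d + 3)") force+
next
  assume "[int x = - int 2] (mod int (d + 3))"
  then have "int (d + 3) dvd int (x + 2)"
    by (simp add: cong_iff_dvd_diff add.commute)
  then have "d + 3 dvd x + 2"
    by (simp only: int_dvd_int_iff)
  then obtain k where k: "x + 2 = k * (d + 3)"
    by (auto simp: dvd_def mult.commute)
  moreover have "k \<noteq> 0"
    using k by (intro notI) simp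
  moreover have "k \<noteq> 1"
    using k assms(2) by (intro notI) simp
  ultimately have "1 \<le> k \<and> (x = k * (d + 3) + 2 \<or> x + 2 = k * (d + 3) \<and> k \<noteq> 1)"
    by simp
  then show ?thesis
    using \<open>x \<le> n\<close> unfolding big_parts_def by blast
qed

text \<open>The multiplicity of the part 2 is determined by the other parts.\<close>

lemma inj_on_Q_partitions:
  assumes "0 < d"
  shows "inj_on (\<lambda>xs. restrict (count_list xs) (big_parts d n)) (Q_partitions d n)"
proof (rule inj_onI)
  fix xs ys
  assume xs: "xs \<in> Q_partitions d n" and ys: "ys \<in> Q_partitions d n"
    and eq: "restrict (count_list xs) (big_parts d n) = restrict (count_list ys) (big_parts d n)"
  let ?B = "big_parts d n"
  have set: "set zs \<subseteq> insert 2 ?B" and sum: "sum_list zs = n" and sorted: "sorted (rev zs)"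
    if "zs \<in> Q_partitions d n" for zs
  proof -
    show "sum_list zs = n" "sorted (rev zs)"
      using that by (auto simp: Q_partitions_def partitions_def sorted_wrt_rev)
    show "set zs \<subseteq> insert 2 ?B"
    proof
      fix x assume x: "x \<in> set zs"
      then have "x \<le> n"
        using member_le_sum_list[OF x] \<open>sum_list zs = n\<close> by simp
      with x that show "x \<in> insert 2 ?B"
        using part_cases[of x d n] assms by (simp add: Q_partitions_def partitions_def)
    qed
  qed
  \<comment> \<open>This keeps the twos separate from the sum over \<open>?B\<close> in
    \<open>decomp\<close>.\<close>
  have two: "2 \<notin> ?B"
  proof
    assume "2 \<in> ?B"
    then obtain k where k: "1 \<le> k" "2 = k * (d + 3) + 2 \<or> 2 + 2 = k * (d + 3) \<and> k \<noteq> 1"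
      unfolding big_parts_def by blast
    then have "k \<noteq> 1" "k * (d + 3) = 4"
      by auto
    moreover have "2 * 4 \<le> k * (d + 3)" if "k \<noteq> 1"
      using k(1) that assms by (intro mult_mono) auto
    ultimately show False
      by simp
  qed
  have decomp: "n = 2 * count_list zs 2 + (\<Sum>p\<in>?B. count_list zs p * p)"
    if "zs \<in> Q_partitions d n" for zs
    using sum_list_map_eq_sum_count2[OF set[OF that], of "\<lambda>x. x"] sum[OF that] two
    by (simp add: finite_big_parts)
  have cnt: "count_list xs p = count_list ys p" if "p \<in> ?B" for p
    using fun_cong[OF eq, of p] that by simp
  then have "(\<Sum>p\<in>?B. count_list xs p * p) = (\<Sum>p\<in>?B. count_list ys p * p)"
    by simp
  then have "count_list xs 2 = count_list ys 2"
    using decomp[OF xs] decomp[OF ys] by linarith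
  with cnt have "count_list xs p = count_list ys p" for p
    using set[OF xs] set[OF ys]
    by (cases "p \<in> insert 2 ?B") (blast, metis count_notin subsetD)
  then have "mset xs = mset ys"
    by (intro multiset_eqI) (simp add: count_mset)
  then have "rev xs = rev ys"
    using sorted[OF xs] sorted[OF ys] by (metis mset_rev properties_for_sort)
  then show "xs = ys"
    by simp
qed

lemma sum_big_parts_le:
  assumes "xs \<in> Q_partitions d n"
  shows "(\<Sum>p\<in>big_parts d n. count_list xs p * p) \<le> n"
proof -
  let ?X = "set xs \<union> big_parts d n"
  have "(\<Sum>p\<in>big_parts d n. count_list xs p * p) \<le> (\<Sum>p\<in>?X. count_list xs p * p)"
    by (intro sum_mono2) (auto simp: finite_big_parts)
  also have "\<dots> = n"
    using sum_list_map_eq_sum_count2[of xs ?X "\<lambda>x. x"] assms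
    by (simp add: finite_big_parts Q_partitions_def partitions_def)
  finally show ?thesis .
qed

lemma count_big_part_le:
  assumes "xs \<in> Q_partitions d n" "p \<in> big_parts d n"
  shows "count_list xs p * p \<le> n"
  using member_le_sum[OF assms(2), of "\<lambda>p. count_list xs p * p"] sum_big_parts_le[OF assms(1)]
  by (simp add: finite_big_parts)

text \<open>The parts \<open>k * (d + 3) + 2\<close> and \<open>k * (d + 3) - 2\<close> both get weight \<open>k\<close>.\<close>

definition weight :: "nat \<Rightarrow> nat \<Rightarrow> nat" where
  "weight d p = (p + 2) div (d + 3)"

lemma big_parts_cases:
  assumes "p \<in> big_parts d n" "2 \<le> d"
  obtains "1 \<le> weight d p" "weight d p \<le> n" "p = weight d p * (d + 3) + 2"
    | "2 \<le> weight d p" "weight d p \<le> n" "p = weight d p * (d + 3) - 2"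
proof -
  obtain k where k: "1 \<le> k" "p = k * (d + 3) + 2 \<or> p + 2 = k * (d + 3) \<and> k \<noteq> 1" "p \<le> n"
    using assms(1) unfolding big_parts_def by blast
  have "k * 5 \<le> k * (d + 3)"
    using assms(2) by (intro mult_left_mono) auto
  moreover have "k * (d + 3) \<le> p + 2"
    using k(2) by linarith
  ultimately have kn: "k \<le> n"
    using k(1,3) by linarith
  from k(2) show thesis
  proof
    assume p: "p = k * (d + 3) + 2"
    have "weight d p = k"
      \<comment> \<open>The numerator is \<open>k * (d + 3) + 4\<close>, and
        \<open>4 < d + 3\<close> because \<open>2 \<le> d\<close>.\<close>
      unfolding weight_def p using assms(2) by (intro div_nat_eqI) (auto simp: algebra_simps)
    then show thesis
      using that(1) p k kn by simp
  next
    assume p: "p + 2 = k * (d + 3) \<and> k \<noteq> 1"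
    then have "weight d p = k"
      by (simp add: weight_def)
    moreover have "p = k * (d + 3) - 2"
      using p by linarith
    ultimately show thesis
      using that(2) p k(1) kn by simp
  qed
qed

text \<open>For \<open>k * (d + 3) - 2\<close> this amounts to \<open>2 \<le> k\<close>: the
  excluded part \<open>d + 1\<close> would violate it.\<close>

lemma weight_le:
  assumes "p \<in> big_parts d n" "2 \<le> d"
  shows "(d + 2) * weight d p \<le> p"
  using assms by (cases rule: big_parts_cases) (auto simp: algebra_simps)

text \<open>Each weight \<open>k \<ge> 1\<close> comes from at most one part of the form +2
  (\<open>?A\<close>), each \<open>k \<ge> 2\<close> from at most one of the form -2
  (\<open>?C\<close>). All factors are at least 1, so the products may be extended up to
  \<open>n\<close>; the missing \<open>k = 1\<close> in \<open>?C\<close> yields the factor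
  \<open>1 - z\<close>.\<close>

lemma prod_big_parts_le:
  fixes z :: real
  assumes z: "0 < z" "z < 1" and "2 \<le> d" "1 \<le> n"
  shows "(\<Prod>p\<in>big_parts d n. 1 / (1 - z ^ weight d p)) \<le> (1 - z) / (\<Prod>k=1..n. 1 - z ^ k)\<^sup>2"
proof -
  let ?f = "\<lambda>k. 1 / (1 - z ^ k)"
  let ?A = "{p \<in> big_parts d n. p = weight d p * (d + 3) + 2}"
  let ?C = "big_parts d n - ?A"
  have f1: "1 \<le> ?f k" if "1 \<le> k" for k
    using z that power_strict_decreasing[of 0 k z] by (simp add: divide_simps)
  have f0: "0 \<le> ?f k" for k
    using z by (simp add: power_le_one)
  have A: "(\<Prod>p\<in>?A. ?f (weight d p)) \<le> (\<Prod>k=1..n. ?f k)"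
  proof -
    have "inj_on (weight d) ?A"
      by (rule inj_onI) (metis (mono_tags) mem_Collect_eq)
    then have "(\<Prod>p\<in>?A. ?f (weight d p)) = (\<Prod>k\<in>weight d ` ?A. ?f k)"
      by (simp only: prod.reindex o_def)
    also have "\<dots> \<le> (\<Prod>k=1..n. ?f k)"
    proof (intro prod_mono2)
      show "weight d ` ?A \<subseteq> {1..n}"
        by (auto elim: big_parts_cases[OF _ \<open>2 \<le> d\<close>])
    qed (use f0 f1 in auto)
    finally show ?thesis .
  qed
  have C: "(\<Prod>p\<in>?C. ?f (weight d p)) \<le> (\<Prod>k=2..n. ?f k)"
  proof -
    have C_cases: "2 \<le> weight d p \<and> weight d p \<le> n \<and> p = weight d p * (d + 3) - 2" if "p \<in> ?C" for p
      using that by (auto elim: big_parts_cases[OF _ \<open>2 \<le> d\<close>])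
    have "inj_on (weight d) ?C"
    proof (rule inj_onI)
      fix x y assume x: "x \<in> ?C" and y: "y \<in> ?C" and eq: "weight d x = weight d y"
      from C_cases[OF x] have "x = weight d x * (d + 3) - 2" by blast
      also have "\<dots> = weight d y * (d + 3) - 2" by (simp only: eq)
      also from C_cases[OF y] have "\<dots> = y" by simp
      finally show "x = y" .
    qed
    then have "(\<Prod>p\<in>?C. ?f (weight d p)) = (\<Prod>k\<in>weight d ` ?C. ?f k)"
      by (simp only: prod.reindex o_def)
    also have "\<dots> \<le> (\<Prod>k=2..n. ?f k)"
    proof (intro prod_mono2)
      show "weight d ` ?C \<subseteq> {2..n}"
      proof (intro image_subsetI)
        fix p assume "p \<in> ?C"
        from C_cases[OF this] show "weight d p \<in> {2..n}"
          by simp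
      qed
    qed (use f0 f1 in auto)
    finally show ?thesis .
  qed
  have "(\<Prod>p\<in>big_parts d n. ?f (weight d p)) = (\<Prod>p\<in>?C. ?f (weight d p)) * (\<Prod>p\<in>?A. ?f (weight d p))"
    by (rule prod.subset_diff) (auto simp: finite_big_parts)
  also have "\<dots> \<le> (\<Prod>k=2..n. ?f k) * (\<Prod>k=1..n. ?f k)"
    using f0 by (intro mult_mono A C prod_nonneg) auto
  also have "(\<Prod>k=1..n. ?f k) = ?f 1 * (\<Prod>k=2..n. ?f k)"
    using \<open>1 \<le> n\<close> by (simp add: prod.atLeast_Suc_atMost numeral_2_eq_2)
  then have "(\<Prod>k=2..n. ?f k) = (1 - z) * (\<Prod>k=1..n. ?f k)"
    using z by simp
  finally show ?thesis
    by (simp add: prod_dividef power2_eq_square)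
qed

text \<open>The generating function of the weights evaluated at \<open>z\<close> is at least \<open>z ^ m\<close> times the
  number of partitions, because all total weights are at most \<open>m\<close>.\<close>

lemma card_Q_partitions_le:
  fixes z :: real
  assumes z: "0 < z" "z < 1" and d: "2 \<le> d" and "1 \<le> n" and m: "n < (d + 2) * (m + 1)"
  shows "card (Q_partitions d n) * z ^ m \<le> (1 - z) / (\<Prod>k=1..n. 1 - z ^ k)\<^sup>2"
proof -
  let ?B = "big_parts d n" and ?r = "\<lambda>xs. restrict (count_list xs) (big_parts d n)"
  let ?P = "PiE ?B (\<lambda>_. {..n})" and ?g = "\<lambda>f. \<Prod>p\<in>?B. (z ^ weight d p) ^ f p"
  have B_pos: "1 \<le> weight d p" "0 < p" if p: "p \<in> ?B" for p
  proof -
    show "1 \<le> weight d p"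
      using p d by (cases rule: big_parts_cases) auto
    then show "0 < p"
      using weight_le[OF p d] by (cases "p = 0") auto
  qed
  have pow: "0 < z ^ weight d p" "z ^ weight d p < 1" if "p \<in> ?B" for p
    using z B_pos[OF that] power_strict_decreasing[of 0 "weight d p" z] by auto
  \<comment> \<open>Capping the multiplicities at \<open>n\<close> makes the function space finite,
    so that the sum over it factors into geometric sums.\<close>
  have image: "?r ` Q_partitions d n \<subseteq> ?P"
  proof (intro image_subsetI restrict_PiE_iff[THEN iffD2] ballI)
    fix xs p assume "xs \<in> Q_partitions d n" "p \<in> ?B"
    then have *: "count_list xs p * p \<le> n" "0 < p"
      by (auto intro: count_big_part_le B_pos)
    then have "count_list xs p \<le> count_list xs p * p"
      by simp
    with *(1) show "count_list xs p \<in> {..n}"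
      unfolding atMost_iff by (rule order_trans[rotated])
  qed
  have ge: "z ^ m \<le> ?g (?r xs)" if xs: "xs \<in> Q_partitions d n" for xs
  proof -
    let ?w = "\<Sum>p\<in>?B. weight d p * count_list xs p"
    have "(d + 2) * ?w = (\<Sum>p\<in>?B. count_list xs p * ((d + 2) * weight d p))"
      unfolding sum_distrib_left by (intro sum.cong) (simp_all only: mult_ac)
    also have "\<dots> \<le> (\<Sum>p\<in>?B. count_list xs p * p)"
      using d by (intro sum_mono mult_left_mono weight_le) auto
    also have "\<dots> \<le> n"
      by (rule sum_big_parts_le[OF xs])
    finally have "(d + 2) * ?w < (d + 2) * (m + 1)"
      using m by (rule le_less_trans)
    then have "?w < m + 1"
      by (simp only: mult_less_cancel1)
    then have "?w \<le> m"
      by simp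
    then have "z ^ m \<le> z ^ ?w"
      using z by (intro power_decreasing) auto
    also have "\<dots> = ?g (?r xs)"
      by (simp add: power_sum power_mult)
    finally show ?thesis .
  qed
  have "card (Q_partitions d n) * z ^ m = (\<Sum>xs\<in>Q_partitions d n. z ^ m)"
    by simp
  also have "\<dots> \<le> (\<Sum>xs\<in>Q_partitions d n. ?g (?r xs))"
    by (intro sum_mono ge)
  also have "\<dots> = (\<Sum>f\<in>?r ` Q_partitions d n. ?g f)"
    using d by (subst sum.reindex[OF inj_on_Q_partitions]) auto
  also have "\<dots> \<le> (\<Sum>f\<in>?P. ?g f)"
    using z by (intro sum_mono2 image finite_PiE finite_big_parts prod_nonneg) auto
  also have "\<dots> = (\<Prod>p\<in>?B. \<Sum>i\<le>n. (z ^ weight d p) ^ i)"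
    by (simp add: prod_sum_PiE finite_big_parts)
  also have "\<dots> \<le> (\<Prod>p\<in>?B. 1 / (1 - z ^ weight d p))"
  proof (intro prod_mono conjI)
    fix p assume p: "p \<in> ?B"
    have "(\<Sum>i\<le>n. (z ^ weight d p) ^ i) = (1 - (z ^ weight d p) ^ Suc n) / (1 - z ^ weight d p)"
      using pow[OF p] by (subst sum_gp0) simp
    also have "\<dots> \<le> 1 / (1 - z ^ weight d p)"
      using z pow[OF p] by (intro divide_right_mono) (auto simp del: power_Suc)
    finally show "(\<Sum>i\<le>n. (z ^ weight d p) ^ i) \<le> 1 / (1 - z ^ weight d p)" .
  qed (use z in \<open>auto intro: sum_nonneg\<close>)
  also have "\<dots> \<le> (1 - z) / (\<Prod>k=1..n. 1 - z ^ k)\<^sup>2"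
    using z d \<open>1 \<le> n\<close> by (rule prod_big_parts_le)
  finally show ?thesis .
qed

text \<open>Below \<open>2 * (d + 2)\<close> the only possible big part is \<open>d + 5\<close>: the
  next one is \<open>2 * (d + 3) - 2\<close>. It occurs at most once, and the twos are then
  determined.\<close>

lemma card_Q_partitions_le_2:
  assumes "2 \<le> d" "n < (d + 2) * 2"
  shows "card (Q_partitions d n) \<le> (if n < d + 5 then 1 else 2)"
proof -
  let ?B = "big_parts d n"
  have B: "?B \<subseteq> {p. p = d + 5 \<and> d + 5 \<le> n}"
  proof
    fix p assume p: "p \<in> ?B"
    then have "p \<le> n" by (simp add: big_parts_def)
    have two: "2 * (d + 3) \<le> weight d p * (d + 3)" if "2 \<le> weight d p"
      using that by (intro mult_right_mono) auto
    from p \<open>2 \<le> d\<close> show "p \<in> {p. p = d + 5 \<and> d + 5 \<le> n}"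
    proof (cases rule: big_parts_cases)
      case 1
      have "\<not> 2 \<le> weight d p"
        using two 1(3) assms \<open>p \<le> n\<close> by (intro notI) simp
      then have "weight d p = 1"
        using 1 by simp
      then show ?thesis
        using 1 \<open>p \<le> n\<close> by simp
    next
      case 2
      then show ?thesis
        using two 2(3) assms \<open>p \<le> n\<close> by simp
    qed
  qed
  have "(\<lambda>xs. restrict (count_list xs) ?B) ` Q_partitions d n \<subseteq> PiE ?B (\<lambda>_. {..1})"
  proof (intro image_subsetI restrict_PiE_iff[THEN iffD2] ballI)
    fix xs p assume "xs \<in> Q_partitions d n" and p: "p \<in> ?B"
    then have "count_list xs p * p \<le> n" "p = d + 5"
      using B by (auto intro: count_big_part_le)
    then have "count_list xs p * (d + 5) < 2 * (d + 5)"
      using assms by simp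
    then show "count_list xs p \<in> {..1}"
      by (simp only: mult_less_cancel2) simp
  qed
  then have "card (Q_partitions d n) \<le> card (PiE ?B (\<lambda>_. {..1::nat}))"
    using assms by (intro card_inj_on_le[OF inj_on_Q_partitions] finite_PiE finite_big_parts) auto
  also have "\<dots> = 2 ^ card ?B"
    by (simp add: card_PiE finite_big_parts numeral_2_eq_2)
  also have "\<dots> \<le> (if n < d + 5 then 1 else 2)"
  proof -
    have "?B \<subseteq> {d + 5}" and "?B = {}" if "n < d + 5"
      using B that by auto
    then show ?thesis
      using B card_mono[of "{d + 5}" ?B] power_increasing[of "card ?B" 1 "2::nat"] by auto
  qed
  finally show ?thesis .
qed

subsection \<open>Comparison\<close>

lemma card_gapped_le_q:
  assumes "1 \<le> a"
  shows "card (gapped a d j n) \<le> q a d n"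
  unfolding q_def
proof (rule card_mono)
  show "gapped a d j n \<subseteq> {xs \<in> partitions n. (\<forall>x\<in>set xs. a \<le> x) \<and>
     (\<forall>i j. i < j \<longrightarrow> j < length xs \<longrightarrow> xs ! j + d \<le> xs ! i)}"
  proof
    fix xs assume xs: "xs \<in> gapped a d j n"
    then have "sorted_wrt (\<ge>) xs"
      by (auto simp: gapped_def intro: sorted_wrt_mono_rel[rotated])
    with xs assms show "xs \<in> {xs \<in> partitions n. (\<forall>x\<in>set xs. a \<le> x) \<and>
     (\<forall>i j. i < j \<longrightarrow> j < length xs \<longrightarrow> xs ! j + d \<le> xs ! i)}"
      by (fastforce simp: gapped_def partitions_def sorted_wrt_iff_nth_less)
  qed
qed (simp add: finite_partitions)

text \<open>With \<open>Suc j\<close> parts the staircase from 2 costs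
  \<open>2 * Suc j + d * t\<close>. Since \<open>Suc j \<le> m\<close>, the excess is at least
  \<open>d * (m - t)\<close>, which is bounded below independently of \<open>d\<close>.\<close>

lemma q_lower_bound:
  assumes "62 \<le> d" "(d + 2) * m \<le> n" "2 * t = j * (j + 1)" "Suc j \<le> m" "t \<le> m"
  shows "(62 * (real m - real t)) ^ j / (fact (Suc j) * fact j) \<le> q 2 d n"
proof -
  have t: "(\<Sum>i\<le>j. i) = t"
    using gauss_sum_nat[of j] assms(3) by (simp add: atMost_atLeast0)
  define x where "x = n - (Suc j * 2 + d * t)"
  have "Suc j * 2 + d * t + 62 * (m - t) \<le> m * 2 + d * t + d * (m - t)"
    using assms by (intro add_mono mult_right_mono) auto
  also have "\<dots> = (d + 2) * m"
    using \<open>t \<le> m\<close> by (simp add: diff_mult_distrib2 distrib_right mult.commute)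
  finally have x: "62 * (m - t) \<le> x" and n: "n = Suc j * 2 + d * (\<Sum>i\<le>j. i) + x"
    using assms(2) by (auto simp: x_def t)
  have "62 * (real m - real t) = real (62 * (m - t))"
    using \<open>t \<le> m\<close> by (simp add: of_nat_diff)
  then have "(62 * (real m - real t)) ^ j \<le> real x ^ j"
    using x by (intro power_mono) (simp_all only: of_nat_le_iff of_nat_0_le_iff)
  then have "(62 * (real m - real t)) ^ j / (fact (Suc j) * fact j) \<le> real x ^ j / (fact (Suc j) * fact j)"
    by (intro divide_right_mono) auto
  also have "\<dots> \<le> card (gapped 2 d (Suc j) n)"
    unfolding n by (rule card_gapped_ge)
  also have "\<dots> \<le> q 2 d n"
    by (simp add: card_gapped_le_q)
  finally show ?thesis .
qed

lemma q_ge_1: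
  assumes "2 \<le> n"
  shows "1 \<le> q 2 d n"
proof -
  have "{[n]} \<subseteq> gapped 2 d 1 n"
    using assms by (auto simp: gapped_def)
  from card_mono[OF finite_gapped this] card_gapped_le_q[of 2 d 1 n] show ?thesis
    by simp
qed

lemma q_ge_2:
  assumes "d + 4 \<le> n"
  shows "2 \<le> q 2 d n"
proof -
  let ?S = "{xs \<in> partitions n. (\<forall>x\<in>set xs. 2 \<le> x) \<and>
     (\<forall>i j. i < j \<longrightarrow> j < length xs \<longrightarrow> xs ! j + d \<le> xs ! i)}"
  \<comment> \<open>The second partition has gap \<open>n - 4\<close>, which is at least
    \<open>d\<close>.\<close>
  have "{[n], [n - 2, 2]} \<subseteq> ?S"
    using assms by (auto simp: partitions_def less_Suc_eq nth_Cons')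
  from card_mono[OF _ this] show ?thesis
    by (simp add: q_def finite_partitions)
qed

section \<open>Upper bounds depending only on \<open>m\<close>\<close>

lemma Q_upper_half:
  assumes "2 \<le> d" "1 \<le> n" "n < (d + 2) * (m + 1)"
  shows "card (Q_partitions d n) \<le> 512/81 * (2::real) ^ m"
proof -
  let ?P = "\<Prod>k=1..n. 1 - (1/2::real) ^ k"
  have "card (Q_partitions d n) * (1/2) ^ m \<le> (1 - 1/2) / ?P\<^sup>2"
    using assms by (intro card_Q_partitions_le) auto
  also have "\<dots> \<le> (1 - 1/2) / (9/32)\<^sup>2"
    using prod_one_minus_half_power_ge[of n]
    by (intro divide_left_mono power_mono mult_pos_pos zero_less_power) auto
  finally show ?thesis
    by (simp add: power_divide field_simps)
qed

text \<open>The choice \<open>z = s / (1 + s)\<close> makes \<open>z / (1 - z) = s\<close>, so the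
  product is at least \<open>exp (- (7/4 * s))\<close>.\<close>

lemma Q_upper_exp:
  fixes s :: real
  assumes "2 \<le> d" "1 \<le> n" "n < (d + 2) * (m + 1)" "0 < s"
  shows "card (Q_partitions d n) \<le> exp (7/2 * s) / (1 + s) * (1 + 1/s) ^ m"
proof -
  define z where "z = s / (1 + s)"
  have z: "0 < z" "z < 1" "1 - z = 1 / (1 + s)" "z / (1 - z) = s" "1 / z = 1 + 1/s"
    using assms(4) by (auto simp: z_def field_simps)
  let ?P = "\<Prod>k=1..n. 1 - z ^ k"
  have P: "exp (- (7/4 * s)) \<le> ?P"
    using prod_one_minus_power_ge[of z n] z by simp
  have "card (Q_partitions d n) * z ^ m \<le> (1 - z) / ?P\<^sup>2"
    using assms z by (intro card_Q_partitions_le) auto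
  also have "\<dots> \<le> (1 - z) / (exp (- (7/4 * s)))\<^sup>2"
    using P z(2) less_le_trans[OF exp_gt_zero P]
    by (intro divide_left_mono power_mono mult_pos_pos zero_less_power) auto
  also have "\<dots> = exp (7/2 * s) / (1 + s)"
    by (simp add: z flip: exp_of_nat_mult exp_minus) (simp add: exp_minus field_simps)
  finally have "card (Q_partitions d n) * z ^ m * (1 / z) ^ m \<le> exp (7/2 * s) / (1 + s) * (1 / z) ^ m"
    using z(1) by (intro mult_right_mono zero_le_power) auto
  moreover have "z ^ m * (1 / z) ^ m = 1"
    using z(1) by (simp flip: power_mult_distrib)
  ultimately show ?thesis
    by (simp add: z mult.assoc)
qed

lemma exp_1_le: "exp 1 \<le> (69/25 :: real)"
proof -
  have "exp 1 = exp (1/32 :: real) ^ 32"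
    by (simp flip: exp_of_nat_mult)
  \<comment> \<open>This is 1 + x + x^2 at x = 1/32.\<close>
  also have "\<dots> \<le> (1057/1024) ^ 32"
    using exp_bound[of "1/32 :: real"] by (intro power_mono) (simp_all add: power2_eq_square)
  also have "\<dots> \<le> 69/25"
    by (simp add: power_divide)
  finally show ?thesis .
qed

lemma Q_upper_two_thirds:
  assumes "2 \<le> d" "1 \<le> n" "n < (d + 2) * (m + 1)"
  shows "card (Q_partitions d n) \<le> 407 * (3/2::real) ^ m"
proof -
  have "exp 1 ^ 7 \<le> (69/25 :: real) ^ 7"
    using exp_1_le by (intro power_mono) auto
  then have "exp 7 / 3 \<le> (407::real)"
    by (simp flip: exp_of_nat_mult) (simp add: power_divide)
  have "card (Q_partitions d n) \<le> exp (7::real) / 3 * (3/2) ^ m"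
    using Q_upper_exp[OF assms, of 2] by simp
  also have "\<dots> \<le> 407 * (3/2) ^ m"
    using \<open>exp 7 / 3 \<le> 407\<close> by (rule mult_right_mono) simp
  finally show ?thesis .
qed

text \<open>Take \<open>s = j/2\<close>, drop the denominator and use
  \<open>1 + 1/s \<le> exp (1/s)\<close>. As \<open>m \<le> j * (j + 2)\<close>, the exponent is at
  most 7/4 j + 2 (j + 2).\<close>

lemma Q_upper_square_range:
  assumes "2 \<le> d" "1 \<le> n" "n < (d + 2) * (m + 1)" and j: "1 \<le> j" "m < (j + 1) * (j + 1)"
  shows "card (Q_partitions d n) \<le> exp (15/4 * real j + 4)"
proof -
  have "card (Q_partitions d n) \<le> exp (7/2 * (j/2)) / (1 + j/2) * (1 + 1/(j/2)) ^ m"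
    using assms by (intro Q_upper_exp) auto
  also have "\<dots> \<le> exp (7/2 * (j/2)) / 1 * exp (1/(j/2)) ^ m"
    using j(1) by (intro mult_mono divide_left_mono power_mono) auto
  also have "\<dots> = exp (7/4 * j + 2 * m / j)"
    by (simp add: exp_add flip: exp_of_nat_mult)
  also have "\<dots> \<le> exp (15/4 * j + 4)"
  proof -
    have "real m \<le> real (j * (j + 2))"
      using j(2) unfolding of_nat_le_iff by simp
    then have "2 * m / j \<le> 2 * (j + 2)"
      using j(1) by (simp add: divide_simps algebra_simps)
    then show ?thesis by simp
  qed
  finally show ?thesis .
qed

text \<open>The right-hand side is the bound of \<open>q_lower_bound\<close> with
  \<open>j = i\<close> at \<open>m = (i + 1)^2\<close>. From \<open>i\<close> to
  \<open>i + 1\<close> it grows by exactly \<open>31 * (1 + 2 / (i + 1)) ^ (i + 1)\<close>, at least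
  93 by Bernoulli, while the left-hand side grows by \<open>exp (15/4)\<close>.\<close>

lemma exp_le_lower_bound:
  assumes "7 \<le> i"
  shows "exp (15/4 * real (Suc i) + 4) \<le> (31 * (real i + 1) * (real i + 2)) ^ i / (fact (Suc i) * fact i)"
  using assms
proof (induction i rule: nat_induct_at_least)
  case base
  have "exp 1 ^ 34 \<le> (69/25 :: real) ^ 34"
    using exp_1_le by (intro power_mono) auto
  also have "\<dots> \<le> (31 * (7 + 1) * (7 + 2)) ^ 7 / (fact 8 * fact 7)"
    by (simp add: fact_numeral power_divide)
  finally show ?case
    by (simp flip: exp_of_nat_mult)
next
  case (Suc i)
  let ?a = "real i + 1"
  let ?D = "fact (Suc i) * fact i :: real"
  have e4: "exp (15/4) \<le> (93::real)"
  proof -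
    have "exp (15/4) \<le> exp (4::real)"
      by simp
    also have "\<dots> = exp 1 ^ 4"
      by (simp flip: exp_of_nat_mult)
    also have "\<dots> \<le> (69/25) ^ 4"
      using exp_1_le by (intro power_mono) auto
    finally show ?thesis
      by (simp add: power_divide)
  qed
  have bern: "3 \<le> (1 + 2 / ?a) ^ Suc i"
  proof -
    have "1 + real (Suc i) * (2 / ?a) = 3"
      by (simp add: field_simps)
    then show ?thesis
      using Bernoulli_inequality[of "2 / ?a" "Suc i"] by (simp add: order_trans[of "-1" 0])
  qed
  have "15/4 * real (Suc (Suc i)) + 4 = 15/4 + (15/4 * real (Suc i) + 4)"
    by (simp add: field_simps)
  then have "exp (15/4 * real (Suc (Suc i)) + 4) = exp (15/4) * exp (15/4 * real (Suc i) + 4)"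
    by (metis exp_add)
  also have "\<dots> \<le> (31 * (1 + 2 / ?a) ^ Suc i) * ((31 * (real i + 1) * (real i + 2)) ^ i / ?D)"
    using e4 bern Suc.IH by (intro mult_mono) auto
  also have "\<dots> = (31 * (real (Suc i) + 1) * (real (Suc i) + 2)) ^ Suc i / (fact (Suc (Suc i)) * fact (Suc i))"
  proof -
    have "1 + 2 / ?a = (?a + 2) / ?a"
      by (simp add: field_simps)
    then have p: "(1 + 2 / ?a) ^ Suc i = (?a + 2) ^ Suc i / ?a ^ Suc i"
      by (simp only: power_divide)
    have f: "fact (Suc (Suc i)) * fact (Suc i) = (?a + 1) * ?a * ?D"
      by (simp add: algebra_simps)
    \<comment> \<open>\<open>X\<close>, \<open>Y\<close>, \<open>W\<close> stand for the
      \<open>i\<close>-th powers of \<open>?a + 2\<close>, \<open>?a\<close>, \<open>?a + 1\<close>;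
      further \<open>u = ?a + 2\<close>, \<open>v = ?a + 1\<close> and
      \<open>c = 31 ^ i\<close>.\<close>
    have cancel: "31 * (u * X / (a * Y)) * (c * Y * W / D) = 31 * v * u * (c * W * X) / (v * a * D)"
      if "a \<noteq> 0" "v \<noteq> 0" "Y \<noteq> 0" "D \<noteq> 0" for a c u v D X Y W :: real
      using that by (simp add: field_simps)
    have sums: "real (Suc i) + 1 = ?a + 1" "real (Suc i) + 2 = ?a + 2" "real i + 2 = ?a + 1"
      by simp_all
    have power: "(31 * (?a + 1) * (?a + 2)) ^ Suc i
        = 31 * (?a + 1) * (?a + 2) * (31 ^ i * (?a + 1) ^ i * (?a + 2) ^ i)"
      by (simp only: power_Suc power_mult_distrib)
    show ?thesis
      unfolding p f sums power unfolding power_Suc power_mult_distrib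
      by (rule cancel) (use of_nat_0_le_iff[of i, where ?'a = real] in \<open>simp_all del: of_nat_0_le_iff\<close>)
  qed
  finally show ?case .
qed

text \<open>On \<open>{m0..m1}\<close> it suffices to compare the lower bound at \<open>m0\<close> with the upper bound at
  \<open>m1\<close>; here \<open>t\<close> is the \<open>j\<close>-th triangular number and \<open>Suc j\<close> the number of parts.\<close>

lemma le_q_on_range:
  assumes "62 \<le> d" "(d + 2) * m \<le> n" "2 * t = j * (j + 1)" "Suc j \<le> m" "t \<le> m0" "m0 \<le> m" "m \<le> m1"
    and "1 \<le> r" "0 \<le> K" "real c \<le> K * r ^ m"
    and le: "K * r ^ m1 \<le> (62 * (real m0 - real t)) ^ j / (fact (Suc j) * fact j)"
  shows "c \<le> q 2 d n"
proof -
  have "real c \<le> K * r ^ m1"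
    using assms by (intro order_trans[OF assms(10)] mult_left_mono power_increasing) auto
  also note le
  also have "(62 * (real m0 - real t)) ^ j / (fact (Suc j) * fact j)
      \<le> (62 * (real m - real t)) ^ j / (fact (Suc j) * fact j)"
    using assms by (intro divide_right_mono power_mono) auto
  also have "\<dots> \<le> q 2 d n"
    using assms by (intro q_lower_bound) auto
  finally show ?thesis by simp
qed

section \<open>Small cases and the final comparison\<close>

lemma Q_partitions_1:
  assumes d: "62 \<le> d"
  shows "Q_partitions d 1 = {}"
proof -
  have False if "xs \<in> Q_partitions d 1" for xs
  proof -
    have xs: "sum_list xs = 1"
      "\<forall>x\<in>set xs. ([int x = int 2] (mod int (d + 3)) \<or> [int x = - int 2] (mod int (d + 3))) \<and> x \<noteq> d + 3 - 2"
      "\<forall>x\<in>set xs. 0 < x"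
      using that by (auto simp: Q_partitions_def partitions_def)
    then obtain x where x: "x \<in> set xs"
      by (cases xs) auto
    then have "x \<le> 1"
      using member_le_sum_list[OF x] xs(1) by simp
    then have "x = 2 \<or> x \<in> big_parts d 1"
      using part_cases[of x d 1] xs x d by auto
    then have "x \<in> big_parts d 1"
      using \<open>x \<le> 1\<close> by auto
    then have "(d + 2) * weight d x \<le> 1" "1 \<le> weight d x"
      using weight_le[of x d 1] big_parts_cases[of x d 1] d \<open>x \<le> 1\<close> by force+
    then have "(d + 2) * 1 \<le> 1"
      using mult_le_mono2[of 1 "weight d x" "d + 2"] by linarith
    then show False
      using d by simp
  qed
  then show ?thesis by blast
qed

lemma Q_le_q:
  assumes d: "62 \<le> d" and n: "1 \<le> n"
  shows "card (Q_partitions d n) \<le> q 2 d n"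
proof -
  define m where "m = n div (d + 2)"
  have mn: "(d + 2) * m \<le> n"
    unfolding m_def by (rule times_div_less_eq_dividend)
  have d2: "2 \<le> d"
    using d by simp
  have nm: "n < (d + 2) * (m + 1)"
    using dividend_less_times_div[of "d + 2" n] by (simp add: m_def)
  \<comment> \<open>The case \<open>n = 1\<close> stands apart because no part of size at least 2
    fits, so \<open>q\<close> vanishes.\<close>
  consider "n = 1" | "2 \<le> n" "m \<le> 1" | "2 \<le> m" "m \<le> 10" | "11 \<le> m" "m \<le> 63" | "64 \<le> m"
    using n by linarith
  then show ?thesis
  proof cases
    case 1
    with Q_partitions_1[OF d] show ?thesis by simp
  next
    case 2
    then have "(d + 2) * (m + 1) \<le> (d + 2) * 2"
      by (intro mult_left_mono) simp_all
    with nm have "n < (d + 2) * 2"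
      by (rule less_le_trans)
    with d have upper: "card (Q_partitions d n) \<le> (if n < d + 5 then 1 else 2)"
      by (intro card_Q_partitions_le_2) simp_all
    show ?thesis
    proof (cases "n < d + 5")
      case True
      with upper q_ge_1[OF \<open>2 \<le> n\<close>, of d] show ?thesis by simp
    next
      case False
      with upper q_ge_2[of d n] show ?thesis by simp
    qed
  next
    case m: 3
    note upper = Q_upper_half[OF d2 n nm]
    \<comment> \<open>In each range the four numbers given are \<open>t\<close>, \<open>j\<close>,
      \<open>m0\<close>, \<open>m1\<close>.\<close>
    consider "m = 2" | "m = 3" | "4 \<le> m" "m \<le> 5" | "6 \<le> m" "m \<le> 8" | "9 \<le> m" "m \<le> 10"
      using m by linarith
    then show ?thesis
    proof cases
      case 1
      then show ?thesis
        by (intro le_q_on_range[OF d mn, of 1 1 2 2, OF _ _ _ _ _ _ _ upper])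
          (auto simp: fact_numeral power_divide)
    next
      case 2
      then show ?thesis
        by (intro le_q_on_range[OF d mn, of 1 1 3 3, OF _ _ _ _ _ _ _ upper])
          (auto simp: fact_numeral power_divide)
    next
      case 3
      then show ?thesis
        by (intro le_q_on_range[OF d mn, of 3 2 4 5, OF _ _ _ _ _ _ _ upper])
          (auto simp: fact_numeral power_divide)
    next
      case 4
      then show ?thesis
        by (intro le_q_on_range[OF d mn, of 3 2 6 8, OF _ _ _ _ _ _ _ upper])
          (auto simp: fact_numeral power_divide)
    next
      case 5
      then show ?thesis
        by (intro le_q_on_range[OF d mn, of 3 2 9 10, OF _ _ _ _ _ _ _ upper])
          (auto simp: fact_numeral power_divide)
    qed
  next
    case m: 4
    note upper = Q_upper_two_thirds[OF d2 n nm]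
    \<comment> \<open>Both last ranges use \<open>j = 7\<close>; comparing the endpoints of 46 to 63
      at once would fail.\<close>
    consider "11 \<le> m" "m \<le> 14" | "15 \<le> m" "m \<le> 22" | "23 \<le> m" "m \<le> 32"
      | "33 \<le> m" "m \<le> 45" | "46 \<le> m" "m \<le> 59" | "60 \<le> m" "m \<le> 63"
      using m by linarith
    then show ?thesis
    proof cases
      case 1
      then show ?thesis
        by (intro le_q_on_range[OF d mn, of 6 3 11 14, OF _ _ _ _ _ _ _ upper])
          (auto simp: fact_numeral power_divide)
    next
      case 2
      then show ?thesis
        by (intro le_q_on_range[OF d mn, of 10 4 15 22, OF _ _ _ _ _ _ _ upper])
          (auto simp: fact_numeral power_divide)
    next
      case 3
      then show ?thesis
        by (intro le_q_on_range[OF d mn, of 15 5 23 32, OF _ _ _ _ _ _ _ upper])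
          (auto simp: fact_numeral power_divide)
    next
      case 4
      then show ?thesis
        by (intro le_q_on_range[OF d mn, of 21 6 33 45, OF _ _ _ _ _ _ _ upper])
          (auto simp: fact_numeral power_divide)
    next
      case 5
      then show ?thesis
        by (intro le_q_on_range[OF d mn, of 28 7 46 59, OF _ _ _ _ _ _ _ upper])
          (auto simp: fact_numeral power_divide)
    next
      case 6
      then show ?thesis
        by (intro le_q_on_range[OF d mn, of 28 7 60 63, OF _ _ _ _ _ _ _ upper])
          (auto simp: fact_numeral power_divide)
    qed
  next
    case m: 5
    have "m < (m + 1) * (m + 1)"
      by simp
    \<comment> \<open>\<open>j\<close> is the integer square root of \<open>m\<close>; with
      \<open>i = j - 1\<close> the lower bound uses \<open>j\<close> parts.\<close>
    then obtain j where lo: "\<not> m < j * j" and hi: "m < (j + 1) * (j + 1)"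
      using ex_least_nat_less[of "\<lambda>k. m < k * k" "m + 1"] by auto
    have "8 \<le> j"
    proof (rule ccontr)
      assume "\<not> 8 \<le> j"
      then have "(j + 1) * (j + 1) \<le> 8 * 8"
        by (intro mult_mono) auto
      with hi m show False by linarith
    qed
    then obtain i where i: "j = Suc i" "7 \<le> i"
      by (cases j) auto
    define t where "t = i * (i + 1) div 2"
    have t2: "2 * t = i * (i + 1)"
      by (simp add: t_def)
    have jm: "j * j \<le> m"
      using lo by simp
    then have "2 * t + 2 * j \<le> 2 * m"
      using t2 i by (simp add: algebra_simps)
    have "real (card (Q_partitions d n)) \<le> exp (15/4 * real j + 4)"
      using \<open>8 \<le> j\<close> by (intro Q_upper_square_range[OF d2 n nm _ hi]) simp
    also have "\<dots> \<le> (31 * (real i + 1) * (real i + 2)) ^ i / (fact (Suc i) * fact i)"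
      using exp_le_lower_bound[OF i(2)] i(1) by simp
    also have "\<dots> \<le> (62 * (real m - real t)) ^ i / (fact (Suc i) * fact i)"
    proof -
      have "real (2 * t) = real (i * (i + 1))" "real (j * j) \<le> real m"
        using t2 jm by (simp_all only: of_nat_le_iff)
      \<comment> \<open>From \<open>m \<ge> (i + 1)^2\<close> and \<open>t = i (i + 1) / 2\<close>
        follows \<open>m - t \<ge> (i + 1) (i + 2) / 2\<close>.\<close>
      then have "31 * (real i + 1) * (real i + 2) \<le> 62 * (real m - real t)"
        using i(1) by (simp add: algebra_simps)
      then show ?thesis
        by (intro divide_right_mono power_mono) auto
    qed
    also have "\<dots> \<le> q 2 d n"
      using \<open>2 * t + 2 * j \<le> 2 * m\<close> i by (intro q_lower_bound[OF d mn t2]) auto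
    finally show ?thesis by simp
  qed
qed

theorem theorem1p2:
  fixes d n :: nat
  assumes "d \<ge> 62" and "n \<ge> 1"
  shows "Delta_minus 2 d n \<ge> 0"
  using Q_le_q[OF assms] by (simp add: Delta_minus_def Q_minus_def Q_partitions_def)

end
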